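(* Let $(X,\tau)$ and $(Y,\sigma)$ be topological spaces. For a function $f \colon (X,\tau) \rightarrow (Y,\sigma)$, the following conditions are equivalent: (1) $f$ is $\mathcal{AB}$-continuous. (2) $f$ is semi-continuous and $\mathcal{B}$-continuous. (3) $f$ is $\beta$-continuous and $\mathcal{B}$-continuous.
   Context: For a subset $A$ of a topological space $X$, $\mathrm{Int}\,A$ denotes the interior and $\overline{A}$ the closure of $A$ in $X$. $A$ is semi-open if $A \subseteq \overline{\mathrm{Int}\,A}$; semi-closed if its complement is semi-open; semi-regular if it is both semi-open and semi-closed; $\beta$-open if $A \subseteq \overline{\mathrm{Int}\,\overline{A}}$. $A$ is an $\mathcal{AB}$-set (respectively $\mathcal{B}$-set) if $A = U \cap V$ with $U$ open and $V$ semi-regular (respectively semi-closed). A function $f \colon X \to Y$ (not assumed continuous) is $\mathcal{AB}$-continuous (respectively $\mathcal{B}$-continuous, semi-continuous, $\beta$-continuous) if for every open $V \subseteq Y$ the preimage $f^{-1}(V)$ is an $\mathcal{AB}$-set (respectively a $\mathcal{B}$-set, a semi-open set, a $\beta$-open set) in $X$. *)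

theory Defs
  imports "HOL-Analysis.Abstract_Topology"
begin

definition semi_open_in :: "'a topology \<Rightarrow> 'a set \<Rightarrow> bool" where
  "semi_open_in X A \<longleftrightarrow> A \<subseteq> topspace X \<and> A \<subseteq> X closure_of (X interior_of A)"

definition semi_closed_in :: "'a topology \<Rightarrow> 'a set \<Rightarrow> bool" where
  "semi_closed_in X A \<longleftrightarrow> A \<subseteq> topspace X \<and> semi_open_in X (topspace X - A)"

definition semi_regular_in :: "'a topology \<Rightarrow> 'a set \<Rightarrow> bool" where
  "semi_regular_in X A \<longleftrightarrow> semi_open_in X A \<and> semi_closed_in X A"

definition beta_open_in :: "'a topology \<Rightarrow> 'a set \<Rightarrow> bool" where
  "beta_open_in X A \<longleftrightarrow>
     A \<subseteq> topspace X \<and> A \<subseteq> X closure_of (X interior_of (X closure_of A))"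

definition AB_set_in :: "'a topology \<Rightarrow> 'a set \<Rightarrow> bool" where
  "AB_set_in X A \<longleftrightarrow> (\<exists>U V. openin X U \<and> semi_regular_in X V \<and> A = U \<inter> V)"

definition B_set_in :: "'a topology \<Rightarrow> 'a set \<Rightarrow> bool" where
  "B_set_in X A \<longleftrightarrow> (\<exists>U V. openin X U \<and> semi_closed_in X V \<and> A = U \<inter> V)"

(* The generalized continuity notions constrain preimages only; that f maps
   topspace X into topspace Y is a separate hypothesis wherever they are used. *)

definition AB_continuous_map :: "'a topology \<Rightarrow> 'b topology \<Rightarrow> ('a \<Rightarrow> 'b) \<Rightarrow> bool" where
  "AB_continuous_map X Y f \<longleftrightarrow>
     (\<forall>V. openin Y V \<longrightarrow> AB_set_in X {x \<in> topspace X. f x \<in> V})"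

definition B_continuous_map :: "'a topology \<Rightarrow> 'b topology \<Rightarrow> ('a \<Rightarrow> 'b) \<Rightarrow> bool" where
  "B_continuous_map X Y f \<longleftrightarrow>
     (\<forall>V. openin Y V \<longrightarrow> B_set_in X {x \<in> topspace X. f x \<in> V})"

definition semi_continuous_map :: "'a topology \<Rightarrow> 'b topology \<Rightarrow> ('a \<Rightarrow> 'b) \<Rightarrow> bool" where
  "semi_continuous_map X Y f \<longleftrightarrow>
     (\<forall>V. openin Y V \<longrightarrow> semi_open_in X {x \<in> topspace X. f x \<in> V})"

definition beta_continuous_map :: "'a topology \<Rightarrow> 'b topology \<Rightarrow> ('a \<Rightarrow> 'b) \<Rightarrow> bool" where
  "beta_continuous_map X Y f \<longleftrightarrow>
     (\<forall>V. openin Y V \<longrightarrow> beta_open_in X {x \<in> topspace X. f x \<in> V})"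

end

theory Submission
  imports Defs
begin

text \<open>The equivalence already holds set by set. The main point is that a \<open>\<beta>\<close>-open set
  \<open>A = U \<inter> V\<close> with \<open>U\<close> open and \<open>V\<close> semi-closed is an \<open>AB\<close>-set: the semi-closure
  \<open>W = A \<union> Int (Cl A)\<close> is the least semi-closed set containing \<open>A\<close>, so that \<open>A \<subseteq> W \<subseteq> V\<close> and
  \<open>A = U \<inter> W\<close>, and \<open>\<beta>\<close>-openness of \<open>A\<close> makes \<open>W\<close> semi-open.\<close>

text \<open>Complementation exchanges closure and interior. In this form, semi-closedness only has
  to be checked on \<open>X interior_of (X closure_of A)\<close>.\<close>

lemma semi_closed_in_iff:
  "semi_closed_in X A \<longleftrightarrow> A \<subseteq> topspace X \<and> X interior_of (X closure_of A) \<subseteq> A"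
proof -
  have "X closure_of (X interior_of (topspace X - A)) =
      topspace X - X interior_of (X closure_of A)"
    by (simp add: interior_of_complement closure_of_complement)
  moreover have "X interior_of (X closure_of A) \<subseteq> topspace X"
    by (rule interior_of_subset_topspace)
  ultimately show ?thesis
    unfolding semi_closed_in_def semi_open_in_def by auto
qed

text \<open>An open \<open>U\<close> meets the closure of a set only inside the closure of its trace
  on \<open>U\<close>; apply this to the interior of \<open>V\<close>.\<close>

lemma semi_open_in_Int_open:
  assumes "openin X U" "semi_open_in X V"
  shows "semi_open_in X (U \<inter> V)"
proof -
  have "U \<inter> V \<subseteq> U \<inter> X closure_of (X interior_of V)"
    using assms(2) unfolding semi_open_in_def by blast
  also have "\<dots> \<subseteq> X closure_of (U \<inter> X interior_of V)"
    using openin_Int_closure_of_subset[OF assms(1)] .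
  also have "\<dots> = X closure_of (X interior_of (U \<inter> V))"
    using assms(1) by (simp add: interior_of_Int interior_of_openin)
  finally show ?thesis
    using openin_subset[OF assms(1)] unfolding semi_open_in_def by blast
qed

lemma semi_open_in_imp_beta_open_in:
  assumes "semi_open_in X A"
  shows "beta_open_in X A"
proof -
  have "X interior_of A \<subseteq> X interior_of (X closure_of A)"
    using assms unfolding semi_open_in_def
    by (intro interior_of_mono closure_of_subset) blast
  then show ?thesis
    using assms closure_of_mono unfolding semi_open_in_def beta_open_in_def by blast
qed

lemma semi_regular_in_semi_closure:
  assumes "beta_open_in X A"
  shows "semi_regular_in X (A \<union> X interior_of (X closure_of A))" (is "semi_regular_in X ?W")
proof -
  have sub: "?W \<subseteq> topspace X"
    using assms interior_of_subset_topspace[of X] unfolding beta_open_in_def by blast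
  \<comment> \<open>\<open>?W\<close> lies between \<open>A\<close> and its closure. Equal closures
    make the semi-closedness criterion for \<open>?W\<close> immediate.\<close>
  have "X closure_of ?W = X closure_of A"
  proof
    have "?W \<subseteq> X closure_of A"
      using sub closure_of_subset[of A X] interior_of_subset[of X] by blast
    then show "X closure_of ?W \<subseteq> X closure_of A"
      by (simp add: closure_of_minimal)
  qed (simp add: closure_of_mono)
  then have closed: "semi_closed_in X ?W"
    using sub by (simp add: semi_closed_in_iff)
  \<comment> \<open>\<beta>-openness covers the part \<open>A\<close>; the other part lies in its
    own closure.\<close>
  have "?W \<subseteq> X closure_of (X interior_of (X closure_of A))"
    using assms closure_of_subset[OF interior_of_subset_topspace]
    unfolding beta_open_in_def by fast
  also have "\<dots> \<subseteq> X closure_of (X interior_of ?W)"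
    by (intro closure_of_mono interior_of_maximal) auto
  finally have "semi_open_in X ?W"
    using sub unfolding semi_open_in_def by blast
  with closed show ?thesis
    unfolding semi_regular_in_def by blast
qed

lemma AB_set_in_imp_semi_open_in: "AB_set_in X A \<Longrightarrow> semi_open_in X A"
  unfolding AB_set_in_def semi_regular_in_def using semi_open_in_Int_open by blast

lemma AB_set_in_imp_B_set_in: "AB_set_in X A \<Longrightarrow> B_set_in X A"
  unfolding AB_set_in_def B_set_in_def semi_regular_in_def by blast

lemma beta_open_in_B_set_in_imp_AB_set_in:
  assumes "beta_open_in X A" "B_set_in X A"
  shows "AB_set_in X A"
proof -
  obtain U V where UV: "openin X U" "semi_closed_in X V" "A = U \<inter> V"
    using assms(2) unfolding B_set_in_def by blast
  let ?W = "A \<union> X interior_of (X closure_of A)"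
  \<comment> \<open>The right side lies in the semi-closed \<open>V\<close>, so \<open>?W\<close>
    does too, and \<open>U \<inter> ?W\<close> cannot exceed \<open>A\<close>.\<close>
  have "X interior_of (X closure_of A) \<subseteq> X interior_of (X closure_of V)"
    using UV(3) by (intro interior_of_mono closure_of_mono) blast
  then have "A = U \<inter> ?W"
    using UV unfolding semi_closed_in_iff by blast
  then show ?thesis
    using UV(1) semi_regular_in_semi_closure[OF assms(1)] unfolding AB_set_in_def by blast
qed

theorem theorem4p2:
  fixes X :: "'a topology" and Y :: "'b topology" and f :: "'a \<Rightarrow> 'b"
  assumes "f \<in> topspace X \<rightarrow> topspace Y"
  shows "(AB_continuous_map X Y f \<longleftrightarrow> semi_continuous_map X Y f \<and> B_continuous_map X Y f) \<and>
         (semi_continuous_map X Y f \<and> B_continuous_map X Y f \<longleftrightarrow>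
          beta_continuous_map X Y f \<and> B_continuous_map X Y f)"
  unfolding AB_continuous_map_def B_continuous_map_def semi_continuous_map_def
    beta_continuous_map_def
  using AB_set_in_imp_semi_open_in AB_set_in_imp_B_set_in semi_open_in_imp_beta_open_in
    beta_open_in_B_set_in_imp_AB_set_in
  by meson

end
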